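(* Let $(\mathbb{N}_0,b,m)$ be a birth-death chain and $W:\mathbb{N}_0\to\mathbb{R}$ a potential; write $W_r=W(r)$, $m_r=m(r)$. Let $(v_r)_{r\ge 0}$ be a real sequence satisfying $$v_{r+1}=v_1+C\sum_{k=1}^{r}\frac{1}{b(k,k+1)}+\sum_{k=1}^{r}\left(\frac{1}{b(k,k+1)}\left(\sum_{n=1}^{k}v_nW_nm_n\right)\right)\qquad\text{for all } r\ge 0,$$ where $C=b(1,0)(v_1-v_0)$. Let $A(z)=\sum_{r=1}^{\infty}v_rz^r$. If $v_r\ne 0$ for all $r\ge 0$, then $A(z)$ is given by $$A(z)\left(1-\sum_{n=1}^{\infty}z^n\left(\sum_{r=0}^{\infty}\beta_{r,n}z^r\right)\right)=C\sum_{r=1}^{\infty}\left(\sum_{k=1}^{r-1}\frac{1}{b(k,k+1)}\right)z^r+\frac{v_1z}{1-z},$$ where the numbers $\beta_{r,n}$ ($r\ge 0$, $n\ge 1$) are defined by the relation $$W_rm_rv_r\sum_{\ell=r}^{r+n-1}\frac{1}{b(\ell,\ell+1)}=\sum_{\gamma=1}^{r}\beta_{r-\gamma,n}\,v_{\gamma}\qquad\text{for all } r\ge 1,\ n\ge 1.$$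
   Context: $\mathbb{N}_0=\{0,1,2,\dots\}$. A birth-death chain $(\mathbb{N}_0,b,m)$ consists of a symmetric edge-weight $b:\mathbb{N}_0\times\mathbb{N}_0\to[0,\infty)$ with $b(x,y)>0$ if and only if $|x-y|=1$, and a measure $m:\mathbb{N}_0\to(0,\infty)$. Generating functions are understood as formal power series in $z$ over $\mathbb{R}$, and $\frac{1}{1-z}$ is identified with its expansion $\sum_{r\ge 0}z^r$. Empty sums equal $0$. *)

theory Defs
  imports Complex_Main "HOL-Computational_Algebra.Formal_Power_Series"
begin

definition birth_death_chain :: "(nat \<Rightarrow> nat \<Rightarrow> real) \<Rightarrow> (nat \<Rightarrow> real) \<Rightarrow> bool" where
  "birth_death_chain b m \<longleftrightarrow>
     (\<forall>x y. b x y \<ge> 0) \<and>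
     (\<forall>x y. b x y = b y x) \<and>
     (\<forall>x y. b x y > 0 \<longleftrightarrow> \<bar>int x - int y\<bar> = 1) \<and>
     (\<forall>x. m x > 0)"

text \<open>The formal power series whose sum starts at index 1; the value \<open>a 0\<close> is ignored.\<close>

definition gen_fun_from_1 :: "(nat \<Rightarrow> real) \<Rightarrow> real fps" where
  "gen_fun_from_1 a = Abs_fps (\<lambda>r. if r \<ge> 1 then a r else 0)"

text \<open>
  For each fixed \<open>n \<ge> 1\<close>, the triangular relation for \<open>\<beta>\<close> has the form below, with
  \<open>\<lambda>r. \<beta> r n\<close> in place of \<open>\<beta>\<close>, so it has exactly one solution whenever \<open>v 1 \<noteq> 0\<close>.
\<close>

lemma triangular_relation_ex1:
  fixes a v :: "nat \<Rightarrow> real"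
  assumes "v 1 \<noteq> 0"
  shows "\<exists>!\<beta>. \<forall>r\<ge>1. a r = (\<Sum>\<gamma>=1..r. \<beta> (r - \<gamma>) * v \<gamma>)"
proof -
  define V where "V = Abs_fps (\<lambda>r. v (Suc r))"
  define A where "A = Abs_fps (\<lambda>r. a (Suc r))"
  have V0: "fps_nth V 0 \<noteq> 0"
    using assms by (simp add: V_def)
  have sum_eq: "(\<Sum>\<gamma>=1..Suc s. \<beta> (Suc s - \<gamma>) * v \<gamma>) = fps_nth (V * Abs_fps \<beta>) s"
    for \<beta> :: "nat \<Rightarrow> real" and s
    unfolding fps_mult_nth One_nat_def sum.shift_bounds_cl_Suc_ivl atLeast0AtMost
    by (simp add: V_def mult.commute)
  have iff: "(\<forall>r\<ge>1. a r = (\<Sum>\<gamma>=1..r. \<beta> (r - \<gamma>) * v \<gamma>)) \<longleftrightarrow> V * Abs_fps \<beta> = A" for \<beta>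
  proof -
    have "(\<forall>r\<ge>1. a r = (\<Sum>\<gamma>=1..r. \<beta> (r - \<gamma>) * v \<gamma>)) \<longleftrightarrow>
          (\<forall>s. a (Suc s) = (\<Sum>\<gamma>=1..Suc s. \<beta> (Suc s - \<gamma>) * v \<gamma>))"
      by (metis One_nat_def Suc_le_D Suc_le_mono zero_le)
    also have "\<dots> \<longleftrightarrow> V * Abs_fps \<beta> = A"
      unfolding sum_eq by (auto simp: fps_eq_iff A_def)
    finally show ?thesis .
  qed
  have inv: "V * inverse V = 1"
    using V0 by (simp add: inverse_mult_eq_1')
  show ?thesis
    unfolding iff
  proof (rule ex1I[of _ "fps_nth (inverse V * A)"])
    show "V * Abs_fps (fps_nth (inverse V * A)) = A"
      using inv by (simp add: fps_nth_inverse mult.assoc[symmetric])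
  next
    fix \<beta> assume "V * Abs_fps \<beta> = A"
    then have "inverse V * A = Abs_fps \<beta>"
      using inv by (metis mult.assoc mult.commute mult_1)
    then show "\<beta> = fps_nth (inverse V * A)"
      by (simp add: fun_eq_iff)
  qed
qed

text \<open>Series of this shape always converge in the library's topology on formal power series.\<close>

lemma summable_fps_X_power_mult:
  fixes F :: "nat \<Rightarrow> real fps"
  shows "summable (\<lambda>n. fps_X ^ (n + 1) * F n)"
proof -
  have "(\<lambda>n. fps_X ^ (n + 1) * F n) sums
        Abs_fps (\<lambda>r. \<Sum>n<r. fps_nth (fps_X ^ (n + 1) * F n) r)"
    unfolding sums_def
  proof (rule tendsto_fpsI)
    fix r
    have "fps_nth (\<Sum>n<N. fps_X ^ (n + 1) * F n) r = (\<Sum>n<r. fps_nth (fps_X ^ (n + 1) * F n) r)"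
      if "N \<ge> r" for N
      unfolding fps_sum_nth using that
      by (intro sum.mono_neutral_right) (auto simp: fps_X_power_mult_nth simp del: power_Suc)
    then show "\<forall>\<^sub>F N in sequentially. fps_nth (\<Sum>n<N. fps_X ^ (n + 1) * F n) r =
          fps_nth (Abs_fps (\<lambda>r. \<Sum>n<r. fps_nth (fps_X ^ (n + 1) * F n) r)) r"
      by (auto simp: eventually_sequentially)
  qed
  then show ?thesis
    by (rule sums_summable)
qed

end

theory Submission
  imports Defs
begin

text \<open>
  Compare coefficients of \<open>z\<^sup>R\<close>. The relation defining \<open>\<beta>\<close> says that multiplying \<open>A(z)\<close> by
  \<open>\<Sum>\<^sub>r \<beta>\<^sub>r\<^sub>,\<^sub>n z\<^sup>r\<close> produces the series with coefficients
  \<open>W\<^sub>r m\<^sub>r v\<^sub>r \<Sum>\<^bsub>l=r\<^esub>\<^bsup>r+n-1\<^esup> 1/b(l,l+1)\<close>. After the shift by \<open>z\<^sup>n\<close>, the contribution to \<open>z\<^sup>R\<close>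
  comes from \<open>r = R - n\<close>, and the inner sum then runs over \<open>r \<le> l \<le> R - 1\<close>: its upper end depends
  on \<open>R\<close> only. Summing over \<open>n\<close> therefore gives a sum over the triangle
  \<open>1 \<le> r \<le> l \<le> R - 1\<close>, and exchanging the two summations turns it into the double sum in the
  recursion for \<open>v\<^sub>R\<close>. What remains of the recursion is the right-hand side of the claim.

  The one analytic point is that multiplication by \<open>A(z)\<close> may be carried out termwise in the infinite
  series over \<open>n\<close> (\<open>fps_nth_mult_suminf_shifted\<close>); this holds because only its first \<open>R\<close> terms
  reach the coefficient of \<open>z\<^sup>R\<close>.
\<close>

lemma fps_nth_suminf_shifted:
  fixes F :: "nat \<Rightarrow> real fps"
  assumes "r \<le> R"
  shows "fps_nth (\<Sum>n. fps_X ^ (n + 1) * F n) r = fps_nth (\<Sum>n<R. fps_X ^ (n + 1) * F n) r"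
proof -
  have stable: "fps_nth (\<Sum>n<N. fps_X ^ (n + 1) * F n) r = fps_nth (\<Sum>n<R. fps_X ^ (n + 1) * F n) r"
    if "N \<ge> R" for N
    unfolding fps_sum_nth using that assms
    by (intro sum.mono_neutral_right) (auto simp: fps_X_power_mult_nth simp del: power_Suc)
  have "(\<lambda>N. \<Sum>n<N. fps_X ^ (n + 1) * F n) \<longlonglongrightarrow> (\<Sum>n. fps_X ^ (n + 1) * F n)"
    using summable_LIMSEQ[OF summable_fps_X_power_mult] .
  then have "\<forall>\<^sub>F N in sequentially.
      fps_nth (\<Sum>n<N. fps_X ^ (n + 1) * F n) r = fps_nth (\<Sum>n. fps_X ^ (n + 1) * F n) r"
    unfolding tendsto_fps_iff by blast
  then obtain N0 where
    "fps_nth (\<Sum>n<N. fps_X ^ (n + 1) * F n) r = fps_nth (\<Sum>n. fps_X ^ (n + 1) * F n) r"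
    if "N \<ge> N0" for N
    unfolding eventually_sequentially by blast
  from this[of "max N0 R"] stable[of "max N0 R"] show ?thesis
    by simp
qed

text \<open>
  Up to degree \<open>R\<close> the series agrees with its partial sum of length \<open>R\<close>, so the product may be
  distributed over that finite sum.
\<close>

lemma fps_nth_mult_suminf_shifted:
  fixes A :: "real fps" and F :: "nat \<Rightarrow> real fps"
  shows "fps_nth (A * (\<Sum>n. fps_X ^ (n + 1) * F n)) R = (\<Sum>n<R. fps_nth (A * F n) (R - (n + 1)))"
proof -
  have "fps_nth (A * (\<Sum>n. fps_X ^ (n + 1) * F n)) R
      = fps_nth (A * (\<Sum>n<R. fps_X ^ (n + 1) * F n)) R"
    unfolding fps_mult_nth by (intro sum.cong refl arg_cong2[where f = "(*)"] fps_nth_suminf_shifted) simp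
  also have "A * (\<Sum>n<R. fps_X ^ (n + 1) * F n) = (\<Sum>n<R. fps_X ^ (n + 1) * (A * F n))"
    by (simp only: sum_distrib_left mult.left_commute)
  also have "fps_nth \<dots> R = (\<Sum>n<R. fps_nth (A * F n) (R - (n + 1)))"
    unfolding fps_sum_nth by (intro sum.cong) (auto simp: fps_X_power_mult_nth simp del: power_Suc)
  finally show ?thesis .
qed

lemma fps_nth_gen_fun_from_1_mult:
  "fps_nth (gen_fun_from_1 v * Abs_fps \<beta>) r = (\<Sum>\<gamma>=1..r. \<beta> (r - \<gamma>) * v \<gamma>)"
  unfolding fps_mult_nth gen_fun_from_1_def
  by (intro sum.mono_neutral_cong_right) (auto simp: mult.commute)

lemma sum_triangle_swap:
  fixes g c :: "nat \<Rightarrow> real"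
  shows "(\<Sum>n<R. g (R - n) * (\<Sum>l=R-n..R. c l)) = (\<Sum>k=1..R. c k * (\<Sum>r=1..k. g r))"
proof -
  have "(\<Sum>n<R. g (R - n) * (\<Sum>l=R-n..R. c l)) = (\<Sum>r=1..R. g r * (\<Sum>l=r..R. c l))"
    by (rule sum.reindex_bij_witness[of _ "\<lambda>r. R - r" "\<lambda>n. R - n"]) auto
  also have "\<dots> = (\<Sum>r=1..R. \<Sum>l | l \<in> {1..R} \<and> r \<le> l. g r * c l)"
    unfolding sum_distrib_left by (intro sum.cong refl) auto
  also have "\<dots> = (\<Sum>l=1..R. \<Sum>r | r \<in> {1..R} \<and> r \<le> l. g r * c l)"
    by (rule sum.swap_restrict) auto
  also have "\<dots> = (\<Sum>k=1..R. c k * (\<Sum>r=1..k. g r))"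
    unfolding sum_distrib_left by (intro sum.cong refl) (auto simp: mult.commute)
  finally show ?thesis .
qed

theorem theorem5p3:
  fixes b :: "nat \<Rightarrow> nat \<Rightarrow> real"
    and m W v :: "nat \<Rightarrow> real"
    and C :: real
    and \<beta> :: "nat \<Rightarrow> nat \<Rightarrow> real"
  assumes "birth_death_chain b m"
    and "C = b 1 0 * (v 1 - v 0)"
    and "\<And>r. v (r + 1) = v 1 + C * (\<Sum>k=1..r. 1 / b k (k + 1))
           + (\<Sum>k=1..r. 1 / b k (k + 1) * (\<Sum>n=1..k. v n * W n * m n))"
    and "\<And>r. v r \<noteq> 0"
    and "\<And>r n. r \<ge> 1 \<Longrightarrow> n \<ge> 1 \<Longrightarrow>
           W r * m r * v r * (\<Sum>l=r..r + n - 1. 1 / b l (l + 1)) = (\<Sum>\<gamma>=1..r. \<beta> (r - \<gamma>) n * v \<gamma>)"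
  shows "gen_fun_from_1 v *
           (1 - (\<Sum>n. fps_X ^ (n + 1) * Abs_fps (\<lambda>r. \<beta> r (n + 1))))
         = fps_const C * gen_fun_from_1 (\<lambda>r. \<Sum>k=1..r - 1. 1 / b k (k + 1))
           + fps_const (v 1) * fps_X / (1 - fps_X)"
proof (rule fps_ext)
  fix R
  let ?S = "\<Sum>n. fps_X ^ (n + 1) * Abs_fps (\<lambda>r. \<beta> r (n + 1))"
  have geom: "fps_const (v 1) * fps_X / (1 - fps_X) = fps_const (v 1) * (fps_X * Abs_fps (\<lambda>_. 1))"
  proof -
    have "inverse (1 - fps_X) = (Abs_fps (\<lambda>_. 1) :: real fps)"
      by (subst fps_inverse_gp'[symmetric]) (rule fps_inverse_idempotent, simp)
    then show ?thesis
      by (simp add: fps_divide_unit mult.assoc)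
  qed
  show "fps_nth (gen_fun_from_1 v * (1 - ?S)) R
      = fps_nth (fps_const C * gen_fun_from_1 (\<lambda>r. \<Sum>k=1..r - 1. 1 / b k (k + 1))
          + fps_const (v 1) * fps_X / (1 - fps_X)) R"
  proof (cases R)
    case 0
    then show ?thesis
      unfolding geom by (simp add: gen_fun_from_1_def)
  next
    case (Suc q)
    have "fps_nth (gen_fun_from_1 v * ?S) R
        = (\<Sum>n<Suc q. \<Sum>\<gamma>=1..q - n. \<beta> (q - n - \<gamma>) (n + 1) * v \<gamma>)"
      unfolding fps_nth_mult_suminf_shifted fps_nth_gen_fun_from_1_mult Suc by simp
    \<comment> \<open>The term \<open>n = q\<close> only involves the vanishing constant coefficient of \<open>A(z)\<close>, while the
      relation for \<open>\<beta>\<close> starts at \<open>r = 1\<close>.\<close>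
    also have "\<dots> = (\<Sum>n<q. \<Sum>\<gamma>=1..q - n. \<beta> (q - n - \<gamma>) (n + 1) * v \<gamma>)"
      by simp
    also have "\<dots> = (\<Sum>n<q. v (q - n) * W (q - n) * m (q - n) * (\<Sum>l=q-n..q. 1 / b l (l + 1)))"
    proof (intro sum.cong refl)
      fix n assume "n \<in> {..<q}"
      then have "q - n \<ge> 1" and "q - n + (n + 1) - 1 = q"
        by auto
      with assms(5)[of "q - n" "n + 1"]
      show "(\<Sum>\<gamma>=1..q - n. \<beta> (q - n - \<gamma>) (n + 1) * v \<gamma>)
          = v (q - n) * W (q - n) * m (q - n) * (\<Sum>l=q-n..q. 1 / b l (l + 1))"
        by (simp add: mult_ac)
    qed
    also have "\<dots> = (\<Sum>k=1..q. 1 / b k (k + 1) * (\<Sum>n=1..k. v n * W n * m n))"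
      by (rule sum_triangle_swap[where g = "\<lambda>r. v r * W r * m r"])
    finally have "fps_nth (gen_fun_from_1 v * (1 - ?S)) R = v 1 + C * (\<Sum>k=1..q. 1 / b k (k + 1))"
      using assms(3)[of q] Suc by (simp add: right_diff_distrib gen_fun_from_1_def)
    then show ?thesis
      unfolding geom by (simp add: gen_fun_from_1_def Suc)
  qed
qed

end
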